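(* Let $U$ be a homeomorphism from a Banach space $X$ onto a Banach space $Y$ with uniformly continuous inverse $V$. Suppose that $d,b>0$ are such that there exist a finite codimensional (closed) subspace $X_0$ of $X$ and an infinite codimensional (closed) subspace $Y_0$ of $Y$ for which $$U[\,d\,\mathrm{Ball}(X_0)]\subset Y_0+b\,\mathrm{Ball}(Y).$$ Then $\omega(V,2b)\ge d/4$, where $\omega(V,t)=\sup\{\|Vy_1-Vy_2\|:\ y_1,y_2\in Y,\ \|y_1-y_2\|\le t\}$ is the modulus of uniform continuity of $V$.
   Context: $\mathrm{Ball}(Z)$ denotes the closed unit ball of a normed space $Z$. *)

theory Defs
  imports "HOL-Analysis.Analysis"
begin

(* Finite-dimensionality of the quotient space by the subspace S: the vector space is
   spanned modulo S by a finite set F, i.e. the cosets f + S, f in F, span the quotient.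
   A subspace S is infinite codimensional iff this fails. *)
definition finite_codim :: "'a::real_vector set \<Rightarrow> bool" where
  "finite_codim S \<longleftrightarrow> (\<exists>F. finite F \<and> span (S \<union> F) = UNIV)"

(* The supremum is taken in the extended reals, so that it is the true supremum even
   without knowing in advance that the set of values is bounded. *)
definition modulus_unif_cont ::
  "('b::real_normed_vector \<Rightarrow> 'a::real_normed_vector) \<Rightarrow> real \<Rightarrow> ereal" where
  "modulus_unif_cont V t =
     Sup {ereal (norm (V y1 - V y2)) | y1 y2. norm (y1 - y2) \<le> t}"

end

theory Submission
  imports Defs
begin

text \<open>
  The theorem is a form of the Gorelik principle. The idea is to perturb the identity of \<open>X\<close> by
  conjugating a translation of \<open>Y\<close>: for a vector \<open>y\<close> with \<open>norm y = 2 * b\<close> put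
  \<open>\<phi> x = V (U x + y)\<close>. If the modulus of \<open>V\<close> at \<open>2 * b\<close> were below \<open>d / 4\<close>, then \<open>\<phi>\<close> would move no
  point by more than \<open>d / 4\<close>, and two facts pull in opposite directions.

  In \<open>X\<close>, a finite codimensional closed subspace cannot be avoided: there is a compact set \<open>A\<close>
  in the ball of radius \<open>d / 2\<close> such that every continuous map on \<open>A\<close> that moves points by at
  most \<open>d / 4\<close> sends some point of \<open>A\<close> into \<open>X0\<close> (\<open>small_displacement_meets_finite_codim\<close>). This
  is a fixed point theorem in disguise. Let \<open>P\<close> be a bounded projection of finite rank with kernel
  \<open>X0\<close>, let \<open>K\<close> be the compact convex closure of the \<open>P\<close>-image of the ball of radius \<open>d / 4\<close>, and let
  \<open>f\<close> be a continuous right inverse of \<open>P\<close> on \<open>K\<close> of norm at most \<open>d / 2\<close>; \<open>A\<close> is the image of \<open>f\<close>. The map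
  \<open>e \<mapsto> P (f e - \<phi> (f e)) = e - P (\<phi> (f e))\<close> sends \<open>K\<close> to itself, and at a fixed point
  \<open>P (\<phi> (f e)) = 0\<close>, that is, \<open>\<phi> (f e) \<in> X0\<close>.

  In \<open>Y\<close>, an infinite codimensional closed subspace is easily avoided: the compact set \<open>U ` A\<close> is
  almost contained in a finite dimensional space, which together with \<open>Y0\<close> still spans a proper
  closed subspace, so Riesz's lemma yields \<open>y\<close> such that \<open>U ` A + y\<close> stays further than \<open>b\<close> from
  \<open>Y0\<close> (\<open>translate_compact_off_infinite_codim\<close>).

  With this \<open>y\<close>, some \<open>x \<in> A\<close> has \<open>\<phi> x \<in> X0\<close> and \<open>norm (\<phi> x) \<le> d / 2 + d / 4 < d\<close>, so that
  \<open>U x + y = U (\<phi> x)\<close> is within \<open>b\<close> of \<open>Y0\<close>: a contradiction.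

  The rank of \<open>P\<close> is an arbitrary number that no type records, whereas Brouwer's theorem for
  Euclidean spaces has its dimension in the type. Therefore Kuhn's combinatorial lemma, where the
  dimension is a number, is used to prove a fixed point theorem for the Hilbert cube, and from it
  Schauder's theorem for compact convex subsets of normed spaces.
\<close>

section \<open>Fixed points in the Hilbert cube and Schauder's theorem\<close>

text \<open>Kuhn's lemma for the \<open>n\<close>-dimensional grid of mesh \<open>1 / n\<close>, with labels that record the sign of
\<open>f x i - x i\<close>, gives a small cell in which each of the first \<open>n\<close> of these differences takes both
signs. Letting the mesh and the number of coordinates change together, a limit point of the cells is
a point where every coordinate of \<open>f x - x\<close> vanishes. Convergence is coordinatewise, so setting
the coordinates from \<open>n\<close> on to zero does no harm.\<close>

lemma hilbert_cube_fixpoint: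
  fixes f :: "(nat \<Rightarrow> real) \<Rightarrow> nat \<Rightarrow> real"
  defines "Q \<equiv> {x. \<forall>i. 0 \<le> x i \<and> x i \<le> 1}"
  assumes cont: "continuous_on Q f" and im: "\<And>x. x \<in> Q \<Longrightarrow> f x \<in> Q"
  shows "\<exists>x\<in>Q. f x = x"
proof -
  have Q_PiE: "Q = (\<Pi>\<^sub>E i\<in>UNIV. {0..1})"
    by (auto simp: Q_def PiE_def Pi_def)
  have "compactin (product_topology (\<lambda>i::nat. euclidean) UNIV) (\<Pi>\<^sub>E i\<in>UNIV. {0..1::real})"
    by (subst compactin_PiE) auto
  then have "compact Q"
    by (simp add: Q_PiE euclidean_product_topology)
  then have seqQ: "seq_compact Q"
    by (rule compact_imp_seq_compact)
  define grid where "grid n v = (\<lambda>i. if i < n then real (v i) / real n else 0)" for n and v :: "nat \<Rightarrow> nat"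
  have gridQ: "grid n v \<in> Q" if "\<And>i. i < n \<Longrightarrow> v i \<le> n" for n v
    using that by (auto simp: grid_def Q_def divide_simps)
  have "\<exists>l. (\<forall>x i. l x i \<le> (1::nat)) \<and>
             (\<forall>x i. x \<in> Q \<and> True \<and> x i = 0 \<longrightarrow> l x i = 0) \<and>
             (\<forall>x i. x \<in> Q \<and> True \<and> x i = 1 \<longrightarrow> l x i = 1) \<and>
             (\<forall>x i. x \<in> Q \<and> True \<and> l x i = 0 \<longrightarrow> x i \<le> f x i) \<and>
             (\<forall>x i. x \<in> Q \<and> True \<and> l x i = 1 \<longrightarrow> f x i \<le> x i)"
    by (rule kuhn_labelling_lemma') (use im in \<open>auto simp: Q_def\<close>)
  then obtain l :: "(nat \<Rightarrow> real) \<Rightarrow> nat \<Rightarrow> nat" where l: "\<And>x i. l x i \<le> 1"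
    "\<And>x i. x \<in> Q \<Longrightarrow> x i = 0 \<Longrightarrow> l x i = 0"
    "\<And>x i. x \<in> Q \<Longrightarrow> x i = 1 \<Longrightarrow> l x i = 1"
    "\<And>x i. x \<in> Q \<Longrightarrow> l x i = 0 \<Longrightarrow> x i \<le> f x i"
    "\<And>x i. x \<in> Q \<Longrightarrow> l x i = 1 \<Longrightarrow> f x i \<le> x i"
    by blast
  \<comment> \<open>\<open>q\<close> is a corner of a cell, and \<open>r\<close>, \<open>s\<close> are points of that cell with opposite labels.\<close>
  have cell: "\<exists>q\<in>Q. \<forall>i<n. \<exists>r\<in>Q. \<exists>s\<in>Q. (\<forall>j. \<bar>r j - q j\<bar> \<le> 1 / real n \<and> \<bar>s j - q j\<bar> \<le> 1 / real n)
      \<and> r i \<le> f r i \<and> f s i \<le> s i" if "n > 0" for n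
  proof -
    obtain q where q: "\<forall>i<n. q i < n"
      "\<forall>i<n. \<exists>r s. (\<forall>j<n. q j \<le> r j \<and> r j \<le> q j + 1) \<and> (\<forall>j<n. q j \<le> s j \<and> s j \<le> q j + 1)
          \<and> l (grid n r) i \<noteq> l (grid n s) i"
    proof (rule kuhn_lemma[of n n "\<lambda>v. l (grid n v)"])
      show "0 < n" by fact
      show "\<forall>x. (\<forall>i<n. x i \<le> n) \<longrightarrow> (\<forall>i<n. l (grid n x) i = 0 \<or> l (grid n x) i = 1)"
        using l(1) by (metis One_nat_def le_Suc_eq le_zero_eq)
      show "\<forall>x. (\<forall>i<n. x i \<le> n) \<longrightarrow> (\<forall>i<n. x i = 0 \<longrightarrow> l (grid n x) i = 0)"
        using l(2) gridQ by (simp add: grid_def)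
      show "\<forall>x. (\<forall>i<n. x i \<le> n) \<longrightarrow> (\<forall>i<n. x i = n \<longrightarrow> l (grid n x) i = 1)"
        using l(3) gridQ by (simp add: grid_def)
    qed blast
    have near: "grid n v \<in> Q \<and> (\<forall>j. \<bar>grid n v j - grid n q j\<bar> \<le> 1 / real n)"
      if "\<forall>j<n. q j \<le> v j \<and> v j \<le> q j + 1" for v
    proof
      show "grid n v \<in> Q"
        using that q(1) by (intro gridQ) (metis Suc_eq_plus1 Suc_leI le_trans)
      show "\<forall>j. \<bar>grid n v j - grid n q j\<bar> \<le> 1 / real n"
      proof
        fix j
        show "\<bar>grid n v j - grid n q j\<bar> \<le> 1 / real n"
        proof (cases "j < n")
          case True
          then have "real (v j) - real (q j) \<le> 1" "0 \<le> real (v j) - real (q j)"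
            using that by (metis diff_le_eq add.commute of_nat_1 of_nat_add of_nat_mono, force)
          then show ?thesis
            using True by (simp add: grid_def divide_simps flip: diff_divide_distrib)
        qed (simp add: grid_def)
      qed
    qed
    show ?thesis
    proof (rule bexI[of _ "grid n q"], intro allI impI)
      show "grid n q \<in> Q"
        using q(1) by (intro gridQ) (simp add: less_imp_le)
      fix i assume "i < n"
      with q(2) obtain r s where rs: "\<forall>j<n. q j \<le> r j \<and> r j \<le> q j + 1"
        "\<forall>j<n. q j \<le> s j \<and> s j \<le> q j + 1" "l (grid n r) i \<noteq> l (grid n s) i"
        by blast
      note R = near[OF rs(1)] and S = near[OF rs(2)]
      have "l (grid n r) i = 0 \<and> l (grid n s) i = 1 \<or> l (grid n r) i = 1 \<and> l (grid n s) i = 0"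
        using l(1)[of "grid n r" i] l(1)[of "grid n s" i] rs(3) by linarith
      then show "\<exists>r\<in>Q. \<exists>s\<in>Q. (\<forall>j. \<bar>r j - grid n q j\<bar> \<le> 1 / real n \<and> \<bar>s j - grid n q j\<bar> \<le> 1 / real n)
          \<and> r i \<le> f r i \<and> f s i \<le> s i"
        using R S l(4,5) by blast
    qed
  qed
  have "\<forall>n. \<exists>q\<in>Q. \<forall>i<Suc n. \<exists>r\<in>Q. \<exists>s\<in>Q.
      (\<forall>j. \<bar>r j - q j\<bar> \<le> 1 / real (Suc n) \<and> \<bar>s j - q j\<bar> \<le> 1 / real (Suc n)) \<and> r i \<le> f r i \<and> f s i \<le> s i"
    using cell by blast
  then obtain q where q: "\<And>n. q n \<in> Q" "\<And>n i. i < Suc n \<Longrightarrow> \<exists>r\<in>Q. \<exists>s\<in>Q.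
      (\<forall>j. \<bar>r j - q n j\<bar> \<le> 1 / real (Suc n) \<and> \<bar>s j - q n j\<bar> \<le> 1 / real (Suc n)) \<and> r i \<le> f r i \<and> f s i \<le> s i"
    by metis
  obtain x h where x: "x \<in> Q" and h: "strict_mono h" "(q \<circ> h) \<longlonglongrightarrow> x"
    using seqQ q(1) unfolding seq_compact_def by metis
  have coord: "(\<lambda>k. v k j) \<longlonglongrightarrow> y j" if "v \<longlonglongrightarrow> y" for v :: "nat \<Rightarrow> nat \<Rightarrow> real" and y j
    by (rule continuous_on_tendsto_compose[OF continuous_on_product_coordinates that]) auto
  \<comment> \<open>The points \<open>r\<close> and \<open>s\<close> that witness the two signs in coordinate \<open>i\<close> vary with the cell, but both
      converge to \<open>x\<close>.\<close>
  have "f x i = x i" for i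
  proof -
    have "\<forall>k. \<exists>r\<in>Q. \<exists>s\<in>Q. i < Suc (h k) \<longrightarrow>
      (\<forall>j. \<bar>r j - q (h k) j\<bar> \<le> 1 / real (Suc (h k)) \<and> \<bar>s j - q (h k) j\<bar> \<le> 1 / real (Suc (h k)))
        \<and> r i \<le> f r i \<and> f s i \<le> s i"
      using q x by meson
    then obtain r s where rs: "\<And>k. r k \<in> Q" "\<And>k. s k \<in> Q"
      "\<And>k. i < Suc (h k) \<Longrightarrow> (\<forall>j. \<bar>r k j - q (h k) j\<bar> \<le> 1 / real (Suc (h k)) \<and> \<bar>s k j - q (h k) j\<bar> \<le> 1 / real (Suc (h k)))
        \<and> r k i \<le> f (r k) i \<and> f (s k) i \<le> s k i"
      by metis
    have ev: "eventually (\<lambda>k. i < Suc (h k)) sequentially"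
      using eventually_ge_at_top[of i] by eventually_elim (meson h(1) le_imp_less_Suc le_trans seq_suble)
    have z: "(\<lambda>k. 1 / real (Suc (h k))) \<longlonglongrightarrow> 0"
      using LIMSEQ_subseq_LIMSEQ[OF LIMSEQ_inverse_real_of_nat h(1)] by (simp add: o_def inverse_eq_divide)
    have conv: "v \<longlonglongrightarrow> x" if "\<And>k j. i < Suc (h k) \<Longrightarrow> \<bar>v k j - q (h k) j\<bar> \<le> 1 / real (Suc (h k))" for v
    proof -
      have "(\<lambda>k. v k j) \<longlonglongrightarrow> x j" for j
      proof -
        have "(\<lambda>k. v k j - q (h k) j) \<longlonglongrightarrow> 0"
          by (rule tendsto_0_le[OF z, of _ 1]) (use ev that in \<open>auto elim!: eventually_mono\<close>)
        from tendsto_add[OF this coord[OF h(2), of j]] show ?thesis by simp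
      qed
      then show ?thesis
        using limitin_componentwise[of "\<lambda>_::nat. euclidean::real topology" UNIV v x sequentially]
        by (simp add: euclidean_product_topology limitin_canonical_iff)
    qed
    have fconv: "(\<lambda>k. f (v k) i) \<longlonglongrightarrow> f x i" if "v \<longlonglongrightarrow> x" "\<And>k. v k \<in> Q" for v
      using continuous_on_tendsto_compose[OF cont that(1) x] that(2) coord by simp
    have rx: "r \<longlonglongrightarrow> x" and sx: "s \<longlonglongrightarrow> x"
      using rs(3) by (auto intro!: conv)
    show "f x i = x i"
    proof (rule antisym)
      show "f x i \<le> x i"
        by (rule tendsto_le[OF _ coord[OF sx] fconv[OF sx rs(2)]])
          (use ev rs(3) in \<open>auto elim!: eventually_mono\<close>)
      show "x i \<le> f x i"
        by (rule tendsto_le[OF _ fconv[OF rx rs(1)] coord[OF rx]])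
          (use ev rs(3) in \<open>auto elim!: eventually_mono\<close>)
    qed
  qed
  then show ?thesis using x by blast
qed

text \<open>Only the points of positive weight need to lie in \<open>C\<close>; this is what a partition of unity supplies,
since there the points of positive weight are near the argument.\<close>

lemma convex_sum_support:
  fixes y :: "nat \<Rightarrow> 'a::real_vector"
  assumes "convex C" "\<And>i. i < n \<Longrightarrow> 0 \<le> c i" "(\<Sum>i<n. c i) = 1" "\<And>i. i < n \<Longrightarrow> c i > 0 \<Longrightarrow> y i \<in> C"
  shows "(\<Sum>i<n. c i *\<^sub>R y i) \<in> C"
proof -
  have "(\<Sum>i<n. c i *\<^sub>R y i) = (\<Sum>i\<in>{i\<in>{..<n}. c i > 0}. c i *\<^sub>R y i)"
    by (rule sum.mono_neutral_right) (use assms(2) in \<open>force+\<close>)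
  moreover have "(\<Sum>i\<in>{i\<in>{..<n}. c i > 0}. c i) = (\<Sum>i<n. c i)"
    by (rule sum.mono_neutral_left) (use assms(2) in \<open>force+\<close>)
  ultimately show ?thesis
    using assms by (auto intro!: convex_sum)
qed

text \<open>Normalised tent functions of radius \<open>\<delta>\<close> around a finite \<open>\<delta>\<close>-net. The centres can be taken from any set
whose closure contains \<open>K\<close>; this is needed below for points of \<open>K\<close> that are only limits of
points with a good preimage.\<close>

lemma tent_partition_of_unity:
  fixes K D :: "'a::metric_space set"
  assumes "compact K" "K \<noteq> {}" "K \<subseteq> closure D" "\<delta> > 0"
  obtains n :: nat and p :: "nat \<Rightarrow> 'a" and w :: "nat \<Rightarrow> 'a \<Rightarrow> real" where
    "n > 0" "\<And>i. i < n \<Longrightarrow> p i \<in> D" "\<And>i. continuous_on K (w i)"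
    "\<And>i x. x \<in> K \<Longrightarrow> 0 \<le> w i x" "\<And>x. x \<in> K \<Longrightarrow> (\<Sum>i<n. w i x) = 1"
    "\<And>i x. x \<in> K \<Longrightarrow> w i x > 0 \<Longrightarrow> dist x (p i) < \<delta>"
proof -
  have "K \<subseteq> (\<Union>x\<in>D. ball x \<delta>)"
    using assms(3,4) by (auto simp: closure_approachable subset_iff)
  then obtain N where N: "N \<subseteq> D" "finite N" "K \<subseteq> (\<Union>x\<in>N. ball x \<delta>)"
    using compactE_image[OF assms(1), of D "\<lambda>x. ball x \<delta>"] by auto
  obtain p n where p: "N = p ` {i::nat. i < n}"
    using finite_imp_nat_seg_image_inj_on[OF N(2)] by blast
  define h where "h i x = max 0 (\<delta> - dist x (p i))" for i x
  define s where "s x = (\<Sum>i<n. h i x)" for x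
  have h0: "h i x \<ge> 0" for i x by (simp add: h_def)
  have s0: "s x > 0" if "x \<in> K" for x
  proof -
    obtain i where "i < n" "dist (p i) x < \<delta>"
      using \<open>x \<in> K\<close> N(3) unfolding p by auto
    then show ?thesis
      unfolding s_def by (intro sum_pos2[of _ i]) (auto simp: h_def dist_commute)
  qed
  have hc: "continuous_on K (h i)" for i
    unfolding h_def by (intro continuous_intros)
  show ?thesis
  proof (rule that[of n p "\<lambda>i x. h i x / s x"])
    show "n > 0" using N(3) assms(2) unfolding p by (cases n) auto
    show "p i \<in> D" if "i < n" for i using that N(1) p by auto
    show "continuous_on K (\<lambda>x. h i x / s x)" for i
      unfolding s_def using s0 s_def hc by (intro continuous_intros) (auto simp: less_imp_neq[symmetric])
    show "0 \<le> h i x / s x" if "x \<in> K" for i x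
      using h0 s0[OF that] by (simp add: less_imp_le)
    show "(\<Sum>i<n. h i x / s x) = 1" if "x \<in> K" for x
      using s0[OF that] by (simp add: s_def flip: sum_divide_distrib)
    show "dist x (p i) < \<delta>" if "x \<in> K" "h i x / s x > 0" for i x
      using that(2) s0[OF that(1)] by (auto simp: h_def zero_less_divide_iff split: if_splits)
  qed
qed

text \<open>With a tent partition of unity, \<open>g\<close> is replaced up to \<open>\<delta>\<close> by a map into the polytope spanned by the net.
In barycentric coordinates that map acts on a cube of finitely many coordinates, so it has a fixed
point, which is a \<open>\<delta>\<close>-approximate fixed point of \<open>g\<close>. By compactness the displacement of \<open>g\<close> attains its
infimum, which is then zero.\<close>

theorem schauder_fixpoint:
  fixes K :: "'a::real_normed_vector set"
  assumes K: "compact K" "convex K" "K \<noteq> {}" and g: "continuous_on K g" "\<And>x. x \<in> K \<Longrightarrow> g x \<in> K"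
  shows "\<exists>x\<in>K. g x = x"
proof -
  have approx: "\<exists>x\<in>K. dist (g x) x \<le> \<delta>" if "\<delta> > 0" for \<delta>
  proof -
    obtain n and p :: "nat \<Rightarrow> 'a" and w :: "nat \<Rightarrow> 'a \<Rightarrow> real" where n: "n > 0" and p: "\<And>i. i < n \<Longrightarrow> p i \<in> K" and wc: "\<And>i. continuous_on K (w i)"
      and w0: "\<And>i x. x \<in> K \<Longrightarrow> 0 \<le> w i x" and w1: "\<And>x. x \<in> K \<Longrightarrow> (\<Sum>i<n. w i x) = 1"
      and wd: "\<And>i x. x \<in> K \<Longrightarrow> w i x > 0 \<Longrightarrow> dist x (p i) < \<delta>"
      using tent_partition_of_unity[OF K(1,3) closure_subset \<open>\<delta> > 0\<close>] by metis
    \<comment> \<open>A point of the cube need not have coordinates that sum to \<open>1\<close>: if the sum exceeds \<open>1\<close>, \<open>\<sigma>\<close> divides by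
      it, and otherwise it gives the missing weight to \<open>p 0\<close>. Where the sum is \<open>1\<close>, \<open>\<sigma>\<close> is the barycentric
      combination.\<close>
    define Q where "Q = {c::nat \<Rightarrow> real. \<forall>i. 0 \<le> c i \<and> c i \<le> 1}"
    define m where "m c = max 1 (\<Sum>i<n. c i)" for c :: "nat \<Rightarrow> real"
    define \<sigma> where "\<sigma> c = p 0 + (\<Sum>i<n. (c i / m c) *\<^sub>R (p i - p 0))" for c :: "nat \<Rightarrow> real"
    define f where "f c = (\<lambda>i. if i < n then w i (g (\<sigma> c)) else 0)" for c
    have m1: "m c \<ge> 1" for c by (simp add: m_def)
    have \<sigma>K: "\<sigma> c \<in> K" if "c \<in> Q" for c
    proof -
      define S where "S = (\<Sum>i<n. c i / m c)"
      have S1: "S \<le> 1"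
        using m1[of c] by (simp add: S_def m_def flip: sum_divide_distrib)
      have c0: "c i / m c \<ge> 0" for i
        using that m1[of c] by (simp add: Q_def)
      have "\<sigma> c = (\<Sum>i<n. (c i / m c + (if i = 0 then 1 - S else 0)) *\<^sub>R p i)"
        using n by (simp add: \<sigma>_def S_def algebra_simps sum.distrib sum_subtractf
          scaleR_sum_left if_distrib[of "\<lambda>r. r *\<^sub>R _"] sum.delta' cong: if_cong)
      also have "\<dots> \<in> K"
      proof (rule convex_sum_support[OF K(2)])
        show "(\<Sum>i<n. c i / m c + (if i = 0 then 1 - S else 0)) = 1"
          using n by (simp add: sum.distrib S_def)
      qed (use c0 S1 p in auto)
      finally show ?thesis .
    qed
    have fQ: "f c \<in> Q" if "c \<in> Q" for c
    proof -
      have "g (\<sigma> c) \<in> K" using \<sigma>K g(2) that by blast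
      then have "w i (g (\<sigma> c)) \<le> 1" if "i < n" for i
        using w0 w1 member_le_sum[of i "{..<n}" "\<lambda>i. w i (g (\<sigma> c))"] that by auto
      then show ?thesis
        using w0 \<open>g (\<sigma> c) \<in> K\<close> by (auto simp: f_def Q_def)
    qed
    have \<sigma>c: "continuous_on Q \<sigma>"
      unfolding \<sigma>_def m_def
      by (intro continuous_intros continuous_on_product_then_coordinatewise continuous_on_id) auto
    have "continuous_on Q (\<lambda>c. w i (g (\<sigma> c)))" for i
      by (intro continuous_on_compose2[OF wc] continuous_on_compose2[OF g(1)] \<sigma>c) (use \<sigma>K g(2) in auto)
    then have "continuous_on Q f"
      unfolding f_def
      by (intro continuous_on_coordinatewise_then_product, rename_tac i, case_tac "i < n") simp_all
    then obtain c where c: "c \<in> Q" "f c = c"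
      using hilbert_cube_fixpoint[of f] fQ by (auto simp: Q_def)
    define y where "y = g (\<sigma> c)"
    have yK: "y \<in> K" using \<sigma>K g(2) c by (simp add: y_def)
    have cw: "c i = w i y" if "i < n" for i
      using that c(2) by (metis f_def y_def)
    have sum1: "(\<Sum>i<n. c i) = 1"
      using w1[OF yK] cw by simp
    then have "\<sigma> c = (\<Sum>i<n. c i *\<^sub>R p i)"
      by (simp add: \<sigma>_def m_def algebra_simps sum_subtractf flip: scaleR_sum_left)
    also have "\<dots> \<in> cball y \<delta>"
      using cw sum1 w0[OF yK] wd[OF yK] by (intro convex_sum_support) (auto simp: less_imp_le)
    finally show ?thesis
      using \<sigma>K c(1) by (auto simp: y_def)
  qed
  have "continuous_on K (\<lambda>x. dist (g x) x)"
    by (intro continuous_intros g)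
  then obtain x where x: "x \<in> K" "\<And>y. y \<in> K \<Longrightarrow> dist (g x) x \<le> dist (g y) y"
    using continuous_attains_inf[OF K(1,3)] by blast
  have "dist (g x) x \<le> \<delta>" if "\<delta> > 0" for \<delta>
    using approx[OF that] x(2) by force
  then have "dist (g x) x \<le> 0"
    by (rule field_le_epsilon) simp
  then show ?thesis using x(1) by auto
qed

section \<open>Closed subspaces of finite and infinite codimension\<close>

text \<open>On \<open>S \<oplus> span {a}\<close> the coefficient of \<open>a\<close> is a bounded functional, since \<open>a\<close> has positive distance from
\<open>S\<close>. This is the only estimate behind the closedness and projection results that follow.\<close>

lemma closed_subspace_coordinate_bound:
  fixes S :: "'a::real_normed_vector set"
  assumes S: "subspace S" "closed S" and a: "a \<notin> S"
  obtains \<delta> where "\<delta> > 0" "\<And>s t. s \<in> S \<Longrightarrow> \<delta> * \<bar>t\<bar> \<le> norm (s + t *\<^sub>R a)"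
proof
  show pos: "infdist a S > 0"
    using S a subspace_0 by (intro infdist_pos_not_in_closed) auto
  fix s t assume s: "s \<in> S"
  show "infdist a S * \<bar>t\<bar> \<le> norm (s + t *\<^sub>R a)"
  proof (cases "t = 0")
    case False
    have "- (s /\<^sub>R t) \<in> S"
      using S s by (simp add: subspace_neg subspace_scale)
    then have "infdist a S \<le> norm (a + s /\<^sub>R t)"
      using infdist_le by (fastforce simp: dist_norm)
    then have "infdist a S * \<bar>t\<bar> \<le> norm (a + s /\<^sub>R t) * \<bar>t\<bar>"
      by (simp add: mult_right_mono)
    also have "\<dots> = norm (t *\<^sub>R (a + s /\<^sub>R t))" by simp
    also have "t *\<^sub>R (a + s /\<^sub>R t) = s + t *\<^sub>R a"
      using False by (simp add: algebra_simps)
    finally show ?thesis .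
  qed simp
qed

text \<open>If \<open>x n - t n *\<^sub>R a \<in> S\<close> and \<open>x\<close> converges, then the coefficients \<open>t n\<close> form a Cauchy sequence by the bound
above, so the components in \<open>S\<close> converge too.\<close>

lemma closed_span_insert:
  fixes S :: "'a::real_normed_vector set"
  assumes S: "subspace S" "closed S"
  shows "closed (span (insert a S))"
proof (cases "a \<in> S")
  case True
  then show ?thesis using S by (simp add: insert_absorb span_eq_iff[THEN iffD2])
next
  case False
  then obtain \<delta> where \<delta>: "\<delta> > 0" "\<And>s t. s \<in> S \<Longrightarrow> \<delta> * \<bar>t\<bar> \<le> norm (s + t *\<^sub>R a)"
    using closed_subspace_coordinate_bound[OF S] by blast
  have mem: "x \<in> span (insert a S) \<longleftrightarrow> (\<exists>t. x - t *\<^sub>R a \<in> S)" for x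
    using S by (simp add: span_insert span_eq_iff[THEN iffD2])
  show ?thesis
    unfolding closed_sequential_limits
  proof (intro allI impI, elim conjE)
    fix x l assume "\<forall>n. x n \<in> span (insert a S)" and lim: "x \<longlonglongrightarrow> l"
    then have "\<forall>n. \<exists>t. x n - t *\<^sub>R a \<in> S"
      by (simp add: mem)
    then obtain t where t: "\<And>n. x n - t n *\<^sub>R a \<in> S"
      by metis
    have "Cauchy t"
    proof (rule metric_CauchyI)
      fix e :: real assume "e > 0"
      then obtain M where M: "\<And>m n. m \<ge> M \<Longrightarrow> n \<ge> M \<Longrightarrow> dist (x m) (x n) < \<delta> * e"
        using metric_CauchyD[OF LIMSEQ_imp_Cauchy[OF lim], of "\<delta> * e"] \<delta>(1) by auto
      have "dist (t m) (t n) < e" if "m \<ge> M" "n \<ge> M" for m n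
      proof -
        have "(x m - t m *\<^sub>R a) - (x n - t n *\<^sub>R a) \<in> S"
          using t S(1) by (simp add: subspace_diff)
        from \<delta>(2)[OF this, of "t m - t n"] have "\<delta> * \<bar>t m - t n\<bar> \<le> norm (x m - x n)"
          by (simp add: algebra_simps)
        also have "\<dots> < \<delta> * e" using M[OF that] by (simp add: dist_norm)
        finally show ?thesis using \<delta>(1) by (simp add: dist_real_def)
      qed
      then show "\<exists>M. \<forall>m\<ge>M. \<forall>n\<ge>M. dist (t m) (t n) < e" by blast
    qed
    then obtain t' where "t \<longlonglongrightarrow> t'"
      using Cauchy_convergent convergent_def by blast
    then have "(\<lambda>n. x n - t n *\<^sub>R a) \<longlonglongrightarrow> l - t' *\<^sub>R a"
      by (intro tendsto_intros lim)
    then have "l - t' *\<^sub>R a \<in> S"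
      by (rule closed_sequentially[OF S(2) t])
    then show "l \<in> span (insert a S)" using mem by blast
  qed
qed

lemma closed_span_Un_finite:
  fixes S :: "'a::real_normed_vector set"
  assumes "finite F" "subspace S" "closed S"
  shows "closed (span (S \<union> F))"
  using assms(1)
proof induction
  case empty
  then show ?case using assms by (simp add: span_eq_iff[THEN iffD2])
next
  case (insert a F)
  have "span (S \<union> insert a F) = span (insert a (span (S \<union> F)))"
    by (simp add: span_insert[of a] span_span)
  then show ?case
    using closed_span_insert[OF subspace_span insert.IH] by simp
qed

text \<open>By induction on the spanning set: enlarge \<open>S\<close> by one vector \<open>a\<close>, take the coordinates modulo the larger
space, and split the remainder into a part in \<open>S\<close> and a multiple of \<open>a\<close>, whose coefficient is bounded. That the
coordinates vanish on \<open>S\<close> makes the resulting finite rank operator a projection even if the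
spanning set is redundant modulo \<open>S\<close>.\<close>

lemma finite_codim_coordinates:
  fixes S :: "'a::real_normed_vector set"
  assumes "finite F" "subspace S" "closed S" "span (S \<union> F) = UNIV"
  shows "\<exists>t. (\<forall>a. bounded_linear (t a)) \<and> (\<forall>x. x - (\<Sum>a\<in>F. t a x *\<^sub>R a) \<in> S) \<and> (\<forall>x\<in>S. \<forall>a\<in>F. t a x = 0)"
  using assms
proof (induction arbitrary: S)
  case empty
  then have "S = UNIV" by (simp add: span_eq_iff[THEN iffD2])
  then show ?case by (intro exI[of _ "\<lambda>_ _. 0"]) (simp add: bounded_linear_zero)
next
  case (insert a F S)
  note S = insert.prems(1,2)
  define S' where "S' = span (insert a S)"
  have "span (S' \<union> F) = UNIV"
  proof -
    have "S \<union> insert a F \<subseteq> S' \<union> F"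
      using span_superset[of "insert a S"] by (auto simp: S'_def)
    then have "span (S \<union> insert a F) \<subseteq> span (S' \<union> F)" by (rule span_mono)
    then show ?thesis using insert.prems(3) by auto
  qed
  moreover have "subspace S'" "closed S'"
    unfolding S'_def using S closed_span_insert by auto
  ultimately obtain t where t: "\<And>b. bounded_linear (t b)"
      "\<And>x. x - (\<Sum>b\<in>F. t b x *\<^sub>R b) \<in> S'" "\<And>x b. x \<in> S' \<Longrightarrow> b \<in> F \<Longrightarrow> t b x = 0"
    using insert.IH[of S'] by blast
  define R where "R x = x - (\<Sum>b\<in>F. t b x *\<^sub>R b)" for x
  have R: "bounded_linear R"
    unfolding R_def by (intro bounded_linear_sub bounded_linear_ident bounded_linear_sum
        bounded_linear_scaleR_const t(1))
  \<comment> \<open>\<open>\<tau>\<close> is the coefficient of \<open>a\<close> in the remainder \<open>R x\<close>; if \<open>a\<close> lies in \<open>S\<close>, it is taken to be zero.\<close>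
  have "\<exists>\<tau>. bounded_linear \<tau> \<and> (\<forall>x. R x - \<tau> x *\<^sub>R a \<in> S) \<and> (\<forall>x. R x \<in> S \<longrightarrow> \<tau> x = 0)"
  proof (cases "a \<in> S")
    case True
    then have "S' = S" using S by (simp add: S'_def insert_absorb span_eq_iff[THEN iffD2])
    then show ?thesis
      using t(2) by (intro exI[of _ "\<lambda>_. 0"]) (simp add: R_def bounded_linear_zero)
  next
    case False
    then obtain \<delta> where \<delta>: "\<delta> > 0" "\<And>s u. s \<in> S \<Longrightarrow> \<delta> * \<bar>u\<bar> \<le> norm (s + u *\<^sub>R a)"
      using closed_subspace_coordinate_bound[OF S] by blast
    have uniq: "u = 0" if "u *\<^sub>R a \<in> S" for u
      using False that S(1) subspace_scale[of S "u *\<^sub>R a" "inverse u"] by (cases "u = 0") auto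
    have "\<forall>x. \<exists>u. R x - u *\<^sub>R a \<in> S"
      using t(2) S by (simp add: R_def S'_def span_insert span_eq_iff[THEN iffD2])
    then obtain \<tau> where \<tau>: "\<And>x. R x - \<tau> x *\<^sub>R a \<in> S" by metis
    have \<tau>_eq: "\<tau> x = u" if "R x - u *\<^sub>R a \<in> S" for x u
    proof -
      have "(R x - u *\<^sub>R a) - (R x - \<tau> x *\<^sub>R a) \<in> S"
        by (rule subspace_diff[OF S(1) that \<tau>])
      then have "(\<tau> x - u) *\<^sub>R a \<in> S" by (simp add: algebra_simps)
      then show ?thesis using uniq by force
    qed
    obtain B where B: "\<And>x. norm (R x) \<le> norm x * B"
      using bounded_linear.bounded[OF R] by blast
    interpret R: bounded_linear R by (fact R)
    have "bounded_linear \<tau>"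
    proof (rule bounded_linear_intro)
      show "\<tau> (x + y) = \<tau> x + \<tau> y" for x y
        using subspace_add[OF S(1) \<tau>[of x] \<tau>[of y]] by (intro \<tau>_eq) (simp add: R.add algebra_simps)
      show "\<tau> (r *\<^sub>R x) = r *\<^sub>R \<tau> x" for r x
        using subspace_scale[OF S(1) \<tau>[of x], of r] by (intro \<tau>_eq) (simp add: R.scaleR algebra_simps)
      show "norm (\<tau> x) \<le> norm x * (B / \<delta>)" for x
        using \<delta>(2)[OF \<tau>[of x], of "\<tau> x"] B[of x] \<delta>(1) by (simp add: field_simps)
    qed
    moreover have "\<tau> x = 0" if "R x \<in> S" for x
      using that by (intro \<tau>_eq) simp
    ultimately show ?thesis using \<tau> by blast
  qed
  then obtain \<tau> where \<tau>: "bounded_linear \<tau>" "\<And>x. R x - \<tau> x *\<^sub>R a \<in> S" "\<And>x. R x \<in> S \<Longrightarrow> \<tau> x = 0"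
    by blast
  have sum_eq: "(\<Sum>b\<in>insert a F. (t(a := \<tau>)) b x *\<^sub>R b) = \<tau> x *\<^sub>R a + (\<Sum>b\<in>F. t b x *\<^sub>R b)" for x
    using insert.hyps by (auto intro!: sum.cong)
  have SS: "S \<subseteq> S'"
    unfolding S'_def using span_superset by blast
  show ?case
  proof (intro exI[of _ "t(a := \<tau>)"] conjI allI ballI)
    show "bounded_linear ((t(a := \<tau>)) b)" for b
      using t(1) \<tau>(1) by simp
    show "x - (\<Sum>b\<in>insert a F. (t(a := \<tau>)) b x *\<^sub>R b) \<in> S" for x
      unfolding sum_eq using \<tau>(2)[of x] by (simp add: R_def algebra_simps)
    show "(t(a := \<tau>)) b x = 0" if x: "x \<in> S" and b: "b \<in> insert a F" for x b
    proof (cases "b = a")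
      case True
      have "R x = x" using x SS t(3) by (auto simp: R_def intro!: sum.neutral)
      then show ?thesis using True x \<tau>(3) by simp
    qed (use x b SS t(3) in auto)
  qed
qed

text \<open>A closed subspace of finite codimension is the kernel of a bounded projection of finite rank. The last
property records finite rank in the form needed: \<open>P\<close> maps balls into finite sums of compact
segments.\<close>

lemma finite_codim_projection:
  fixes S :: "'a::real_normed_vector set"
  assumes "subspace S" "closed S" "finite_codim S"
  obtains P :: "'a \<Rightarrow> 'a" where "bounded_linear P" "\<And>x. P (P x) = P x" "\<And>x. P x = 0 \<longleftrightarrow> x \<in> S"
    "\<And>r. \<exists>C. compact C \<and> P ` cball 0 r \<subseteq> C"
proof -
  obtain F where F: "finite F" "span (S \<union> F) = UNIV"
    using assms(3) by (auto simp: finite_codim_def)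
  obtain t where t: "\<And>a. bounded_linear (t a)" "\<And>x. x - (\<Sum>a\<in>F. t a x *\<^sub>R a) \<in> S"
      "\<And>x a. x \<in> S \<Longrightarrow> a \<in> F \<Longrightarrow> t a x = 0"
    using finite_codim_coordinates[OF F(1) assms(1,2) F(2)] by blast
  define P where "P x = (\<Sum>a\<in>F. t a x *\<^sub>R a)" for x
  have P: "bounded_linear P"
    unfolding P_def by (intro bounded_linear_sum bounded_linear_scaleR_const t(1))
  have ker: "P x = 0 \<longleftrightarrow> x \<in> S" for x
    using t(2)[of x] t(3)[of x] by (auto simp: P_def)
  have "P (x - P x) = 0" for x
    using t(2) ker by (simp add: P_def)
  then have idem: "P (P x) = P x" for x
    by (simp add: linear_diff[OF bounded_linear.linear[OF P]])
  have "\<exists>C. compact C \<and> P ` cball 0 r \<subseteq> C" for r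
    unfolding P_def using F(1)
  proof induction
    case empty
    show ?case by (intro exI[of _ "{0}"]) auto
  next
    case (insert a F)
    then obtain C where C: "compact C" "(\<lambda>x. \<Sum>b\<in>F. t b x *\<^sub>R b) ` cball 0 r \<subseteq> C" by blast
    obtain B where B: "\<And>x. norm (t a x) \<le> norm x * B" "B > 0"
      using bounded_linear.pos_bounded[OF t(1)] by blast
    define I where "I = (\<lambda>u::real. u *\<^sub>R a) ` cball 0 (r * B)"
    have "compact I"
      unfolding I_def by (intro compact_continuous_image continuous_intros) auto
    then have "compact {x + y |x y. x \<in> I \<and> y \<in> C}"
      using C(1) by (rule compact_sums)
    moreover have "t a x *\<^sub>R a \<in> I" if "x \<in> cball 0 r" for x
    proof -
      have "norm x * B \<le> r * B"
        using that B(2) by (intro mult_right_mono) auto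
      then have "\<bar>t a x\<bar> \<le> r * B"
        using B(1)[of x] by simp
      then show ?thesis by (auto simp: I_def)
    qed
    ultimately show ?case
      using C(2) insert.hyps by (intro exI[of _ "{x + y |x y. x \<in> I \<and> y \<in> C}"]) force
  qed
  with that P idem ker show ?thesis by blast
qed

text \<open>Riesz's lemma, for vectors of norm \<open>R\<close>: take a vector outside \<open>W\<close>, subtract an almost nearest
point of \<open>W\<close>, and rescale.\<close>

lemma riesz_proper_subspace:
  fixes W :: "'a::real_normed_vector set"
  assumes W: "subspace W" "closed W" "W \<noteq> UNIV" and rR: "0 < r" "r < R"
  obtains y where "norm y = R" "\<And>w. w \<in> W \<Longrightarrow> r < norm (y - w)"
proof -
  obtain v where v: "v \<notin> W" using W(3) by blast
  define \<rho> where "\<rho> = infdist v W"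
  have \<rho>: "\<rho> > 0"
    unfolding \<rho>_def using W v subspace_0 by (intro infdist_pos_not_in_closed) auto
  have "\<rho> < \<rho> * (R / r)" using \<rho> rR by (simp add: field_simps)
  moreover have "W \<noteq> {}" using W(1) subspace_0 by auto
  ultimately obtain w0 where w0: "w0 \<in> W" "dist v w0 < \<rho> * (R / r)"
    unfolding \<rho>_def infdist_notempty[OF \<open>W \<noteq> {}\<close>]
    by (subst (asm) cINF_less_iff) auto
  define k where "k = R / norm (v - w0)"
  have n0: "norm (v - w0) > 0" using w0 v by auto
  have k: "k > 0" using n0 rR by (simp add: k_def)
  show ?thesis
  proof (rule that[of "k *\<^sub>R (v - w0)"])
    show "norm (k *\<^sub>R (v - w0)) = R" using n0 rR by (simp add: k_def)
    fix w assume "w \<in> W"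
    then have "w0 + w /\<^sub>R k \<in> W"
      using W(1) w0(1) by (simp add: subspace_add subspace_scale)
    then have "\<rho> \<le> norm (v - (w0 + w /\<^sub>R k))"
      unfolding \<rho>_def by (metis infdist_le dist_norm)
    then have "k * \<rho> \<le> norm (k *\<^sub>R (v - (w0 + w /\<^sub>R k)))" using k by simp
    also have "k *\<^sub>R (v - (w0 + w /\<^sub>R k)) = k *\<^sub>R (v - w0) - w"
      using k by (simp add: algebra_simps)
    finally have "k * \<rho> \<le> norm (k *\<^sub>R (v - w0) - w)" .
    moreover have "r < k * \<rho>"
      using w0(2) n0 rR by (simp add: k_def dist_norm field_simps)
    ultimately show "r < norm (k *\<^sub>R (v - w0) - w)" by linarith
  qed
qed

section \<open>The Gorelik principle\<close>

text \<open>A continuous right inverse of \<open>P\<close> whose values have norm at most \<open>r + \<epsilon>\<close>, an elementary case of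
the Bartle-Graves theorem. Choose preimages \<open>x i\<close> of norm at most \<open>r\<close> for the points \<open>p i\<close> of an
\<open>\<epsilon>\<close>-net. Near \<open>p i\<close> the map \<open>e \<mapsto> x i + (e - p i)\<close> is an exact right inverse of \<open>P\<close>, as \<open>P\<close> is the identity
on its range, and it has norm at most \<open>r + \<epsilon>\<close>. Both properties survive averaging with a partition of
unity.\<close>

lemma continuous_lift_closure_image_cball:
  fixes P :: "'a::real_normed_vector \<Rightarrow> 'a"
  defines "K r \<equiv> closure (P ` cball 0 r)"
  assumes P: "bounded_linear P" "\<And>x. P (P x) = P x" and K: "compact (K r)" and "r \<ge> 0" "\<epsilon> > 0"
  obtains f where "continuous_on (K r) f" "\<And>e. e \<in> K r \<Longrightarrow> P (f e) = e" "f ` K r \<subseteq> cball 0 (r + \<epsilon>)"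
proof -
  interpret P: bounded_linear P by (fact P(1))
  have "K r \<noteq> {}" using \<open>r \<ge> 0\<close> by (auto simp: K_def)
  then obtain n and p :: "nat \<Rightarrow> 'a" and w :: "nat \<Rightarrow> 'a \<Rightarrow> real" where p: "\<And>i. i < n \<Longrightarrow> p i \<in> P ` cball 0 r"
    and wc: "\<And>i. continuous_on (K r) (w i)"
    and w0: "\<And>i e. e \<in> K r \<Longrightarrow> 0 \<le> w i e" and w1: "\<And>e. e \<in> K r \<Longrightarrow> (\<Sum>i<n. w i e) = 1"
    and wd: "\<And>i e. e \<in> K r \<Longrightarrow> w i e > 0 \<Longrightarrow> dist e (p i) < \<epsilon>"
    using tent_partition_of_unity[OF K _ _ \<open>\<epsilon> > 0\<close>, of "P ` cball 0 r"] unfolding K_def by (metis order_refl)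
  have "\<forall>i. \<exists>x. i < n \<longrightarrow> norm x \<le> r \<and> P x = p i"
    using p by (fastforce simp: image_iff)
  then obtain x where x: "\<And>i. i < n \<Longrightarrow> norm (x i) \<le> r" "\<And>i. i < n \<Longrightarrow> P (x i) = p i"
    by metis
  have fix_K: "P e = e" if "e \<in> K r" for e
  proof -
    have "closed {e. P e = e}"
      by (intro closed_Collect_eq P.continuous_on continuous_on_id)
    then have "K r \<subseteq> {e. P e = e}"
      unfolding K_def by (rule closure_minimal[rotated]) (auto simp: P(2))
    then show ?thesis using that by blast
  qed
  define f where "f e = (\<Sum>i<n. w i e *\<^sub>R (x i + (e - p i)))" for e
  show ?thesis
  proof
    show "continuous_on (K r) f"
      unfolding f_def by (intro continuous_intros wc)
    show "P (f e) = e" if e: "e \<in> K r" for e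
    proof -
      have Pp: "P (p i) = p i" if "i < n" for i
        using p[OF that] P(2) by auto
      have "P (f e) = (\<Sum>i<n. w i e *\<^sub>R e)"
        unfolding f_def P.sum
        by (intro sum.cong) (simp_all add: P.scaleR P.add P.diff x fix_K[OF e] Pp)
      then show ?thesis using w1[OF e] by (simp flip: scaleR_sum_left)
    qed
    show "f ` K r \<subseteq> cball 0 (r + \<epsilon>)"
    proof
      fix y assume "y \<in> f ` K r"
      then obtain e where e: "e \<in> K r" "y = f e" by blast
      have "x i + (e - p i) \<in> cball 0 (r + \<epsilon>)" if "i < n" "w i e > 0" for i
        using norm_triangle_ineq[of "x i" "e - p i"] x(1)[OF that(1)] wd[OF e(1) that(2)]
        by (simp add: dist_norm norm_minus_commute del: minus_add_distrib)
      then show "y \<in> cball 0 (r + \<epsilon>)"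
        unfolding e(2) f_def using w0[OF e(1)] w1[OF e(1)] by (intro convex_sum_support) auto
    qed
  qed
qed

text \<open>The set \<open>A\<close> is the image of \<open>f\<close>, a continuous right inverse of a projection \<open>P\<close> with kernel \<open>S\<close>. Points
\<open>f e - \<phi> (f e)\<close> have norm at most \<open>r\<close>, so \<open>P\<close> sends them back to the domain of \<open>f\<close>; a fixed point
of \<open>e \<mapsto> P (f e - \<phi> (f e)) = e - P (\<phi> (f e))\<close> is a point with \<open>\<phi> (f e) \<in> S\<close>.\<close>

lemma small_displacement_meets_finite_codim:
  fixes S :: "'a::real_normed_vector set"
  assumes S: "subspace S" "closed S" "finite_codim S" and "r \<ge> 0" "\<epsilon> > 0"
  obtains A where "compact A" "A \<subseteq> cball 0 (r + \<epsilon>)"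
    "\<And>\<phi>. continuous_on A \<phi> \<Longrightarrow> (\<And>x. x \<in> A \<Longrightarrow> norm (\<phi> x - x) \<le> r) \<Longrightarrow> \<exists>x\<in>A. \<phi> x \<in> S"
proof -
  obtain P :: "'a \<Rightarrow> 'a" where P: "bounded_linear P" "\<And>x. P (P x) = P x" and ker: "\<And>x. P x = 0 \<longleftrightarrow> x \<in> S"
    and "\<And>r. \<exists>C. compact C \<and> P ` cball 0 r \<subseteq> C"
    using finite_codim_projection[OF S] by blast
  then obtain C where C: "compact C" "P ` cball 0 r \<subseteq> C" by blast
  interpret P: bounded_linear P by (fact P(1))
  define K where "K = closure (P ` cball 0 r)"
  have K: "compact K"
    unfolding K_def using C closure_minimal[OF C(2) compact_imp_closed[OF C(1)]]
      compact_Int_closed[OF C(1) closed_closure[of "P ` cball 0 r"]] by (simp add: inf.absorb_iff2)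
  have Kconv: "convex K"
    unfolding K_def by (intro convex_closure convex_linear_image P.linear convex_cball)
  have Kne: "K \<noteq> {}" using \<open>r \<ge> 0\<close> by (auto simp: K_def)
  obtain f where f: "continuous_on K f" "\<And>e. e \<in> K \<Longrightarrow> P (f e) = e" "f ` K \<subseteq> cball 0 (r + \<epsilon>)"
    using continuous_lift_closure_image_cball[OF P, of r \<epsilon>] K \<open>r \<ge> 0\<close> \<open>\<epsilon> > 0\<close> unfolding K_def by blast
  show ?thesis
  proof
    show "compact (f ` K)" by (rule compact_continuous_image[OF f(1) K])
    show "f ` K \<subseteq> cball 0 (r + \<epsilon>)" by (fact f(3))
    fix \<phi> assume \<phi>: "continuous_on (f ` K) \<phi>" "\<And>x. x \<in> f ` K \<Longrightarrow> norm (\<phi> x - x) \<le> r"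
    have "\<exists>e\<in>K. P (f e - \<phi> (f e)) = e"
    proof (rule schauder_fixpoint[OF K Kconv Kne])
      show "continuous_on K (\<lambda>e. P (f e - \<phi> (f e)))"
        by (intro P.continuous_on continuous_intros f(1) continuous_on_compose2[OF \<phi>(1) f(1)]) auto
      show "P (f e - \<phi> (f e)) \<in> K" if "e \<in> K" for e
      proof -
        have "f e - \<phi> (f e) \<in> cball 0 r"
          using \<phi>(2)[of "f e"] that by (simp add: norm_minus_commute)
        then show ?thesis unfolding K_def by (intro subsetD[OF closure_subset] imageI)
      qed
    qed
    then obtain e where e: "e \<in> K" "P (f e - \<phi> (f e)) = e" by blast
    then have "P (\<phi> (f e)) = 0" using f(2) by (simp add: P.diff)
    then show "\<exists>x\<in>f ` K. \<phi> x \<in> S" using ker e(1) by blast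
  qed
qed

text \<open>A finite \<open>\<eta>\<close>-net of \<open>B\<close> and \<open>S\<close> together span a closed subspace, proper because \<open>S\<close> has infinite
codimension. A vector \<open>y\<close> of norm \<open>R\<close> and distance more than \<open>b + \<eta>\<close> from it is as required,
because replacing a point of \<open>B\<close> by its neighbour in the net costs less than \<open>\<eta>\<close>.\<close>

lemma translate_compact_off_infinite_codim:
  fixes S B :: "'a::real_normed_vector set"
  assumes S: "subspace S" "closed S" "\<not> finite_codim S" and B: "compact B" and b: "0 < b" "b < R"
  obtains y where "norm y = R" "\<And>u s. u \<in> B \<Longrightarrow> s \<in> S \<Longrightarrow> b < norm (u + y - s)"
proof -
  define \<eta> where "\<eta> = (R - b) / 2"
  have \<eta>: "\<eta> > 0" "b + \<eta> < R" using b by (auto simp: \<eta>_def field_simps)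
  have "B \<subseteq> (\<Union>x\<in>B. ball x \<eta>)" using \<eta> by force
  then obtain F where F: "F \<subseteq> B" "finite F" "B \<subseteq> (\<Union>x\<in>F. ball x \<eta>)"
    using compactE_image[OF B, of B "\<lambda>x. ball x \<eta>"] by auto
  define W where "W = span (S \<union> F)"
  have W: "subspace W" "closed W" "W \<noteq> UNIV"
    using closed_span_Un_finite[OF F(2) S(1,2)] S(3) F(2) by (auto simp: W_def finite_codim_def)
  obtain y where y: "norm y = R" "\<And>w. w \<in> W \<Longrightarrow> b + \<eta> < norm (y - w)"
    using riesz_proper_subspace[OF W, of "b + \<eta>" R] \<eta> b by (metis add_pos_pos)
  show ?thesis
  proof
    show "norm y = R" by (fact y(1))
    fix u s assume u: "u \<in> B" and s: "s \<in> S"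
    obtain v where v: "v \<in> F" "norm (v - u) < \<eta>" using F(3) u by (auto simp: dist_norm)
    have "s \<in> W" "v \<in> W" using s v(1) by (auto simp: W_def span_base)
    then have "s - v \<in> W" using W(1) subspace_diff by blast
    then have "b + \<eta> < norm (y - (s - v))" by (rule y(2))
    also have "y - (s - v) = (u + y - s) + (v - u)" by simp
    also have "norm \<dots> \<le> norm (u + y - s) + norm (v - u)" by (rule norm_triangle_ineq)
    finally show "b < norm (u + y - s)" using v(2) by linarith
  qed
qed

theorem theorem1p1:
  fixes U :: "'a::banach \<Rightarrow> 'b::banach" and V :: "'b \<Rightarrow> 'a" and d b :: real
  assumes "homeomorphism UNIV UNIV U V"
    and "uniformly_continuous_on UNIV V"
    and "d > 0" and "b > 0"
    and "\<exists>X0 Y0. subspace X0 \<and> closed X0 \<and> finite_codim X0 \<and>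
           subspace Y0 \<and> closed Y0 \<and> \<not> finite_codim Y0 \<and>
           U ` ((*\<^sub>R) d ` (X0 \<inter> cball 0 1)) \<subseteq> Y0 + (*\<^sub>R) b ` cball 0 1"
  shows "modulus_unif_cont V (2 * b) \<ge> ereal (d / 4)"
proof (rule ccontr)
  assume "\<not> modulus_unif_cont V (2 * b) \<ge> ereal (d / 4)"
  then have small: "norm (V y1 - V y2) \<le> d / 4" if "norm (y1 - y2) \<le> 2 * b" for y1 y2
  proof -
    have "ereal (norm (V y1 - V y2)) \<le> modulus_unif_cont V (2 * b)"
      unfolding modulus_unif_cont_def using that by (intro Sup_upper) blast
    then have "ereal (norm (V y1 - V y2)) \<le> ereal (d / 4)"
      using \<open>\<not> modulus_unif_cont V (2 * b) \<ge> ereal (d / 4)\<close> by (meson le_cases order_trans)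
    then show ?thesis by (simp only: ereal_less_eq)
  qed
  obtain X0 Y0 where X0: "subspace X0" "closed X0" "finite_codim X0"
    and Y0: "subspace Y0" "closed Y0" "\<not> finite_codim Y0"
    and incl: "U ` ((*\<^sub>R) d ` (X0 \<inter> cball 0 1)) \<subseteq> Y0 + (*\<^sub>R) b ` cball 0 1"
    using assms(5) by blast
  have VU: "\<And>x. V (U x) = x" and UV: "\<And>y. U (V y) = y"
    and cU: "continuous_on UNIV U" and cV: "continuous_on UNIV V"
    using assms(1) by (auto simp: homeomorphism_def)
  \<comment> \<open>The slack \<open>\<epsilon> = d / 4\<close> leaves room: \<open>norm x \<le> d / 2\<close> on \<open>A\<close>, and \<open>\<phi>\<close> adds at most \<open>d / 4\<close>.\<close>
  obtain A where A: "compact A" "A \<subseteq> cball 0 (d / 4 + d / 4)"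
    "\<And>\<phi>. continuous_on A \<phi> \<Longrightarrow> (\<And>x. x \<in> A \<Longrightarrow> norm (\<phi> x - x) \<le> d / 4) \<Longrightarrow> \<exists>x\<in>A. \<phi> x \<in> X0"
    using small_displacement_meets_finite_codim[OF X0, of "d / 4" "d / 4"] \<open>d > 0\<close> by auto
  have "compact (U ` A)"
    by (rule compact_continuous_image[OF continuous_on_subset[OF cU] A(1)]) auto
  then obtain y where y: "norm y = 2 * b" "\<And>u s. u \<in> U ` A \<Longrightarrow> s \<in> Y0 \<Longrightarrow> b < norm (u + y - s)"
    using translate_compact_off_infinite_codim[OF Y0, of "U ` A" b "2 * b"] \<open>b > 0\<close> by auto
  define \<phi> where "\<phi> x = V (U x + y)" for x
  have disp: "norm (\<phi> x - x) \<le> d / 4" for x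
    using small[of "U x + y" "U x"] y(1) by (simp add: \<phi>_def VU)
  have "continuous_on A \<phi>"
    unfolding \<phi>_def
    by (intro continuous_on_compose2[OF cV] continuous_intros continuous_on_subset[OF cU]) auto
  then obtain x where x: "x \<in> A" "\<phi> x \<in> X0"
    using A(3) disp by blast
  have "norm (\<phi> x) \<le> d"
    using norm_triangle_ineq[of x "\<phi> x - x"] disp[of x] A(2) x(1) \<open>d > 0\<close> by auto
  then have "\<phi> x /\<^sub>R d \<in> X0 \<inter> cball 0 1"
    using x(2) X0(1) \<open>d > 0\<close> by (simp add: subspace_scale field_simps)
  then have "d *\<^sub>R (\<phi> x /\<^sub>R d) \<in> (*\<^sub>R) d ` (X0 \<inter> cball 0 1)" by blast
  then have "U (\<phi> x) \<in> Y0 + (*\<^sub>R) b ` cball 0 1"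
    using incl \<open>d > 0\<close> by auto
  then obtain s z where "s \<in> Y0" "norm z \<le> 1" "U x + y = s + b *\<^sub>R z"
    by (auto simp: \<phi>_def UV elim!: set_plus_elim)
  moreover from this have "norm (U x + y - s) \<le> b"
    using \<open>b > 0\<close> by (simp add: mult_left_le)
  ultimately show False
    using y(2)[of "U x" s] x(1) by fastforce
qed

end
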